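(* Let $\mathbb K=\mathbb R$ or $\mathbb C$, let $\mathbf A\in\mathbb K^{n\times n}$ and $\mathbf H\in\mathbb K^{n\times n}$ be non-singular, and let $\mathbf W\in\mathbb K^{n\times n}$ be Hermitian positive definite. Let $\mathbf b,\mathbf x_0\in\mathbb K^n$ with $\mathbf r_0=\mathbf b-\mathbf A\mathbf x_0\neq \mathbf 0$, and let $\mathbf r_i=\mathbf b-\mathbf A\mathbf x_i$ be the residual of the $i$-th iterate $\mathbf x_i$ of weighted and preconditioned GMRES (WP-GMRES) with right preconditioner $\mathbf H$ and weight matrix $\mathbf W$. All infima below are over nonzero $\mathbf y\in\mathbb K^n$. Then, for every $i\ge 0$: (1) $$\frac{\|\mathbf r_i\|_{\mathbf W}}{\|\mathbf r_0\|_{\mathbf W}}\le\left[1-\inf_{\mathbf y\ne 0}\frac{|\langle \mathbf A\mathbf H\mathbf y,\mathbf y\rangle_{\mathbf W}|^2}{\|\mathbf A\mathbf H\mathbf y\|_{\mathbf W}^2\,\|\mathbf y\|_{\mathbf W}^2}\right]^{i/2}.$$ (2) If $\mathbf H=\mathbf W$ is Hermitian positive definite, then the right-hand side of (1) is at most $$\left[1-\inf_{\mathbf y\ne 0}\frac{|\langle \mathbf M(\mathbf A^{-1})\mathbf y,\mathbf y\rangle|}{\langle \mathbf H\mathbf y,\mathbf y\rangle}\times\inf_{\mathbf y\ne 0}\frac{|\langle \mathbf M(\mathbf A)\mathbf y,\mathbf y\rangle|}{\langle \mathbf H^{-1}\mathbf y,\mathbf y\rangle}\right]^{i/2}.$$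 (3) If $\mathbf H=\mathbf W$ is Hermitian positive definite and $\mathbf A$ is positive definite, then the bound in (2) is in turn at most $$\left[1-\frac{1/\kappa(\mathbf H\mathbf M(\mathbf A))}{1+\rho(\mathbf M(\mathbf A)^{-1}\mathbf N(\mathbf A))^2}\right]^{i/2}.$$ In particular, in each case the corresponding quantity bounds $\|\mathbf r_i\|_{\mathbf W}/\|\mathbf r_0\|_{\mathbf W}$ from above.
   Context: $n\ge1$. $\langle\mathbf x,\mathbf y\rangle=\mathbf y^*\mathbf x$ is the Euclidean inner product. For Hermitian positive definite $\mathbf W$, $\langle\mathbf x,\mathbf y\rangle_{\mathbf W}=\langle\mathbf W\mathbf x,\mathbf y\rangle=\mathbf y^*\mathbf W\mathbf x$ and $\|\mathbf x\|_{\mathbf W}=\langle\mathbf x,\mathbf x\rangle_{\mathbf W}^{1/2}$. For $\mathbf B\in\mathbb K^{n\times n}$, $\mathbf M(\mathbf B)=\frac12(\mathbf B+\mathbf B^* )$ is its Hermitian part and $\mathbf N(\mathbf B)=\frac12(\mathbf B-\mathbf B^* )$ its skew-Hermitian part. $\mathbf A$ is called positive definite (not necessarily Hermitian) if $\mathbf M(\mathbf A)$ is Hermitian positive definite. $\rho(\cdot)$ is the spectral radius (largest modulus of the complex eigenvalues). $\kappa(\mathbf H\mathbf M(\mathbf A))=\lambda_{\max}(\mathbf H\mathbf M(\mathbf A))/\lambda_{\min}(\mathbf H\mathbf M(\mathbf A))$ is the condition number, the ratio of the largest to the smallest eigenvalue of $\mathbf H\mathbf M(\mathbf A)$ (these eigenvalues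 are real and positive). WP-GMRES with right preconditioning: given the initial guess $\mathbf x_0$, the $i$-th iterate $\mathbf x_i$ is the minimizer of $\|\mathbf b-\mathbf A\mathbf x\|_{\mathbf W}$ over $\mathbf x\in\mathbf x_0+\mathcal K_i$, where $\mathcal K_i=\operatorname{span}\{\mathbf H\mathbf r_0,\mathbf H\mathbf A\mathbf H\mathbf r_0,\dots,(\mathbf H\mathbf A)^{i-1}\mathbf H\mathbf r_0\}$ and $\mathcal K_0=\{\mathbf 0\}$. *)

theory Defs
  imports "HOL-Analysis.Analysis"
begin

text \<open>
  The scalar field is a parameter \<open>K :: complex set\<close>, used only for \<open>K = \<real>\<close> or \<open>K = UNIV\<close>.
  Vectors and matrices over \<open>K\<close> are complex ones all of whose entries lie in \<open>K\<close>; for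
  \<open>K = \<real>\<close> the conjugate transpose is then the transpose, and matrix inverses stay in \<open>K\<close>.
\<close>

definition vecs :: "complex set \<Rightarrow> (complex^'n) set" where
  "vecs K = {x. \<forall>i. x $ i \<in> K}"

definition mats :: "complex set \<Rightarrow> (complex^'n^'n) set" where
  "mats K = {B. \<forall>i j. B $ i $ j \<in> K}"

definition nonzero_vecs :: "complex set \<Rightarrow> (complex^'n) set" where
  "nonzero_vecs K = vecs K - {0}"

definition cinner :: "complex^'n \<Rightarrow> complex^'n \<Rightarrow> complex" where
  "cinner x y = (\<Sum>i\<in>UNIV. cnj (y $ i) * x $ i)"

definition conj_transpose :: "complex^'n^'n \<Rightarrow> complex^'n^'n" where
  "conj_transpose B = (\<chi> i j. cnj (B $ j $ i))"

definition herm_part :: "complex^'n^'n \<Rightarrow> complex^'n^'n" where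
  "herm_part B = (\<chi> i j. (B $ i $ j + conj_transpose B $ i $ j) / 2)"

definition skew_part :: "complex^'n^'n \<Rightarrow> complex^'n^'n" where
  "skew_part B = (\<chi> i j. (B $ i $ j - conj_transpose B $ i $ j) / 2)"

text \<open>For Hermitian \<open>W\<close> the number \<open>cinner (W *v x) x\<close> is real, so taking \<open>Re\<close> below
  only changes its type.\<close>

definition herm_pos_def :: "complex set \<Rightarrow> complex^'n^'n \<Rightarrow> bool" where
  "herm_pos_def K W \<longleftrightarrow> conj_transpose W = W \<and> (\<forall>x\<in>nonzero_vecs K. 0 < Re (cinner (W *v x) x))"

definition pos_def :: "complex set \<Rightarrow> complex^'n^'n \<Rightarrow> bool" where
  "pos_def K A \<longleftrightarrow> herm_pos_def K (herm_part A)"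

definition winner :: "complex^'n^'n \<Rightarrow> complex^'n \<Rightarrow> complex^'n \<Rightarrow> complex" where
  "winner W x y = cinner (W *v x) y"

definition wnorm :: "complex^'n^'n \<Rightarrow> complex^'n \<Rightarrow> real" where
  "wnorm W x = sqrt (Re (winner W x x))"

text \<open>All complex eigenvalues, whatever the field \<open>K\<close> of the entries.\<close>

definition eigenvalues :: "complex^'n^'n \<Rightarrow> complex set" where
  "eigenvalues B = {c. \<exists>v. v \<noteq> 0 \<and> B *v v = c *s v}"

definition spectral_radius :: "complex^'n^'n \<Rightarrow> real" where
  "spectral_radius B = Max (cmod ` eigenvalues B)"

text \<open>Meant for matrices whose eigenvalues are all real and positive.\<close>

definition cond_number :: "complex^'n^'n \<Rightarrow> real" where
  "cond_number B = Max (Re ` eigenvalues B) / Min (Re ` eigenvalues B)"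

text \<open>The \<open>K\<close>-linear span of \<open>v, B v, \<dots>, B\<^sup>i\<^sup>-\<^sup>1 v\<close>; it is \<open>{0}\<close> for \<open>i = 0\<close>.\<close>

definition krylov :: "complex set \<Rightarrow> complex^'n^'n \<Rightarrow> complex^'n \<Rightarrow> nat \<Rightarrow> (complex^'n) set" where
  "krylov K B v i = {\<Sum>j<i. c j *s (((*v) B ^^ j) v) | c. \<forall>j<i. c j \<in> K}"

definition wp_gmres_iterate ::
  "complex set \<Rightarrow> complex^'n^'n \<Rightarrow> complex^'n^'n \<Rightarrow> complex^'n^'n \<Rightarrow> complex^'n \<Rightarrow> complex^'n
    \<Rightarrow> nat \<Rightarrow> complex^'n \<Rightarrow> bool" where
  "wp_gmres_iterate K A H W b x0 i x \<longleftrightarrow>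
     is_arg_min (\<lambda>z. wnorm W (b - A *v z))
       (\<lambda>z. z \<in> (+) x0 ` krylov K (H ** A) (H *v (b - A *v x0)) i) x"

text \<open>
  The power \<open>t\<^bsup>i/2\<^esup>\<close> for \<open>t \<ge> 0\<close>. It is not written with \<open>powr\<close> because \<open>0 powr 0 = 0\<close>,
  whereas the value needed at \<open>t = 0\<close>, \<open>i = 0\<close> is \<open>1\<close>.
\<close>

definition half_power :: "real \<Rightarrow> nat \<Rightarrow> real" where
  "half_power t i = sqrt t ^ i"

definition gmres_bound1 ::
  "complex set \<Rightarrow> complex^'n^'n \<Rightarrow> complex^'n^'n \<Rightarrow> complex^'n^'n \<Rightarrow> nat \<Rightarrow> real" where
  "gmres_bound1 K A H W i = half_power
     (1 - (INF y\<in>nonzero_vecs K.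
        (cmod (winner W ((A ** H) *v y) y))\<^sup>2 / ((wnorm W ((A ** H) *v y))\<^sup>2 * (wnorm W y)\<^sup>2))) i"

definition gmres_bound2 ::
  "complex set \<Rightarrow> complex^'n^'n \<Rightarrow> complex^'n^'n \<Rightarrow> nat \<Rightarrow> real" where
  "gmres_bound2 K A H i = half_power
     (1 - (INF y\<in>nonzero_vecs K.
             cmod (cinner (herm_part (matrix_inv A) *v y) y) / Re (cinner (H *v y) y))
        * (INF y\<in>nonzero_vecs K.
             cmod (cinner (herm_part A *v y) y) / Re (cinner (matrix_inv H *v y) y))) i"

definition gmres_bound3 :: "complex^'n^'n \<Rightarrow> complex^'n^'n \<Rightarrow> nat \<Rightarrow> real" where
  "gmres_bound3 A H i = half_power
     (1 - (1 / cond_number (H ** herm_part A))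
        / (1 + (spectral_radius (matrix_inv (herm_part A) ** skew_part A))\<^sup>2)) i"

end

theory Submission
  imports Defs
begin

text \<open>
  The convergence estimate is that of a one-dimensional projection method.  With \<open>r\<close> the current
  residual and \<open>a\<close> a scalar, \<open>x + a H r\<close> is an admissible competitor for the next GMRES iterate
  (\<open>krylov_step\<close>), and its residual is \<open>r - a A H r\<close>.  Choosing \<open>a\<close> so that \<open>a A H r\<close> is the
  \<open>W\<close>-orthogonal projection of \<open>r\<close> multiplies \<open>\<parallel>r\<parallel>\<^sup>2\<close> by one minus the quotient in the first bound
  (\<open>wnorm_optimal_step\<close>); the GMRES iterate does at least as well, and one iterates.

  When \<open>H = W\<close>, the substitution \<open>z = H y\<close>, \<open>w = A z\<close> turns the quotient into
  \<open>\<bar>\<langle>A z, z\<rangle>\<bar>\<^sup>2 / (\<langle>H w, w\<rangle> \<langle>H\<^sup>-\<^sup>1 z, z\<rangle>)\<close>.  Since \<open>\<langle>A\<^sup>-\<^sup>1 w, w\<rangle>\<close> is the conjugate of \<open>\<langle>A z, z\<rangle>\<close>,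
  and real parts of such forms are the forms of Hermitian parts, the quotient dominates the
  product of the two quotients in the second bound (\<open>field_of_values_quotient_split\<close>).

  For the third bound write \<open>A = M + N\<close> with Hermitian and skew-Hermitian parts.  The infimum
  involving \<open>M\<close> is a Rayleigh quotient of \<open>H M\<close> in the \<open>H\<^sup>-\<^sup>1\<close> inner product, so it is at least
  the smallest eigenvalue of \<open>H M\<close>.  For the other one, put \<open>w = A v = M u\<close> with
  \<open>u = v + M\<^sup>-\<^sup>1 N v\<close>.  Then \<open>\<langle>H w, w\<rangle> = \<langle>H M u, M u\<rangle>\<close> is at most the largest eigenvalue of \<open>H M\<close>
  times \<open>\<langle>M u, u\<rangle>\<close>, and as \<open>M\<^sup>-\<^sup>1 N\<close> is skew-adjoint in the \<open>M\<close> inner product, Pythagoras gives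
  \<open>\<langle>M u, u\<rangle> \<le> (1 + \<rho>(M\<^sup>-\<^sup>1 N)\<^sup>2) \<langle>M v, v\<rangle>\<close> (\<open>energy_of_preconditioned_operator\<close>), where
  \<open>\<langle>M v, v\<rangle> = \<langle>M(A\<^sup>-\<^sup>1) w, w\<rangle>\<close>.

  All spectral facts come from one variational statement, \<open>exists_eigenvalue_ge_rayleigh\<close>: for an
  operator that is self-adjoint in a positive definite inner product, the maximum of the Rayleigh
  quotient is an eigenvalue.  Eigenvalues are complex even for real data, so positive definiteness
  over the reals is first extended to complex vectors (\<open>herm_pos_def_complexify\<close>).
\<close>

section \<open>The Hermitian inner product\<close>

lemma cinner_add_left: "cinner (x + y) z = cinner x z + cinner y z"
  by (simp add: cinner_def algebra_simps sum.distrib)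

lemma cinner_add_right: "cinner x (y + z) = cinner x y + cinner x z"
  by (simp add: cinner_def algebra_simps sum.distrib)

lemma cinner_diff_left: "cinner (x - y) z = cinner x z - cinner y z"
  by (simp add: cinner_def algebra_simps sum_subtractf)

lemma cinner_scale_left: "cinner (c *s x) y = c * cinner x y"
  by (simp add: cinner_def sum_distrib_left mult_ac)

lemma cinner_scale_right: "cinner x (c *s y) = cnj c * cinner x y"
  by (simp add: cinner_def sum_distrib_left mult_ac)

lemma cinner_zero_left [simp]: "cinner 0 y = 0"
  and cinner_zero_right [simp]: "cinner x 0 = 0"
  by (simp_all add: cinner_def)

lemma cinner_commute: "cinner y x = cnj (cinner x y)"
  by (simp add: cinner_def mult_ac)

lemma Re_cinner_self: "Re (cinner x x) = (\<Sum>i\<in>UNIV. (cmod (x $ i))\<^sup>2)"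
  unfolding cinner_def Re_sum cmod_power2 by (simp add: power2_eq_square)

lemma Re_cinner_self_eq_0_iff: "Re (cinner x x) = 0 \<longleftrightarrow> x = 0"
  unfolding Re_cinner_self by (subst sum_nonneg_eq_0_iff) (auto simp: vec_eq_iff)

lemma cinner_adjoint: "cinner (B *v x) y = cinner x (conj_transpose B *v y)"
  unfolding cinner_def matrix_vector_mult_def conj_transpose_def
  by (simp add: sum_distrib_left sum_distrib_right, subst sum.swap, simp add: mult_ac)

lemma conj_transpose_invol [simp]: "conj_transpose (conj_transpose B) = B"
  by (simp add: conj_transpose_def vec_eq_iff)

lemma conj_transpose_mult: "conj_transpose (A ** B) = conj_transpose B ** conj_transpose A"
  by (simp add: conj_transpose_def matrix_matrix_mult_def vec_eq_iff mult.commute)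

lemma conj_transpose_uminus: "conj_transpose (- B) = - conj_transpose B"
  by (simp add: conj_transpose_def vec_eq_iff)

lemma conj_transpose_herm_part: "conj_transpose (herm_part B) = herm_part B"
  by (simp add: conj_transpose_def herm_part_def vec_eq_iff add.commute)

lemma conj_transpose_skew_part: "conj_transpose (skew_part B) = - skew_part B"
  by (simp add: conj_transpose_def skew_part_def vec_eq_iff field_simps)

lemma herm_part_plus_skew_part: "herm_part B + skew_part B = B"
  by (simp add: herm_part_def skew_part_def vec_eq_iff field_simps)

lemma matrix_vector_mult_scale: "B *v (c *s x) = c *s (B *v x)" for B :: "complex^'n^'n"
  by (rule vec.scale)

definition quad_form :: "complex^'n^'n \<Rightarrow> complex^'n \<Rightarrow> real" where
  "quad_form P x = Re (cinner (P *v x) x)"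

lemma quad_form_zero [simp]: "quad_form P 0 = 0"
  by (simp add: quad_form_def)

lemma quad_form_scale: "quad_form P (c *s x) = (cmod c)\<^sup>2 * quad_form P x"
proof -
  have "cinner (P *v (c *s x)) (c *s x) = (c * cnj c) * cinner (P *v x) x"
    by (simp add: matrix_vector_mult_scale cinner_scale_left cinner_scale_right)
  then show ?thesis
    unfolding quad_form_def complex_norm_square[symmetric] by simp
qed

text \<open>For Hermitian \<open>P\<close> the two mixed terms are conjugate, so they add up to twice a real part.\<close>

lemma quad_form_add:
  assumes "conj_transpose P = P"
  shows "quad_form P (x + y) = quad_form P x + 2 * Re (cinner (P *v x) y) + quad_form P y"
proof -
  have "cinner (P *v y) x = cnj (cinner (P *v x) y)"
    by (metis assms cinner_adjoint cinner_commute)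
  then show ?thesis
    by (simp add: quad_form_def matrix_vector_right_distrib cinner_add_left cinner_add_right)
qed

lemma cinner_hermitian_self_real:
  assumes "conj_transpose P = P"
  shows "cinner (P *v x) x = of_real (quad_form P x)"
proof -
  have "cinner (P *v x) x = cnj (cinner (P *v x) x)"
    by (metis assms cinner_adjoint cinner_commute)
  then show ?thesis
    unfolding quad_form_def by (metis Reals_cnj_iff of_real_Re)
qed

text \<open>The form of the Hermitian part is the real part of the form; all passages between
  \<open>B\<close> and \<open>herm_part B\<close> below rest on this.\<close>

lemma cinner_herm_part: "cinner (herm_part B *v x) x = of_real (quad_form B x)"
proof -
  have "herm_part B *v x = (1/2) *s (B *v x + conj_transpose B *v x)"
    by (simp add: herm_part_def matrix_vector_mult_def vec_eq_iff sum.distrib[symmetric]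
        sum_divide_distrib algebra_simps add_divide_distrib)
  then have "cinner (herm_part B *v x) x = (1/2) * (cinner (B *v x) x + cinner (conj_transpose B *v x) x)"
    by (simp add: cinner_scale_left cinner_add_left)
  also have "cinner (conj_transpose B *v x) x = cnj (cinner (B *v x) x)"
    by (metis cinner_adjoint cinner_commute)
  finally show ?thesis
    by (simp add: quad_form_def complex_eq_iff)
qed

lemma continuous_on_quad_form: "continuous_on S (quad_form P)"
  unfolding quad_form_def cinner_def matrix_vector_mult_def
  by (simp, intro continuous_intros)

section \<open>Positive definite matrices\<close>

lemma herm_pos_def_UNIV_iff:
  "herm_pos_def UNIV P \<longleftrightarrow> conj_transpose P = P \<and> (\<forall>x. x \<noteq> 0 \<longrightarrow> 0 < quad_form P x)"
  by (auto simp: herm_pos_def_def nonzero_vecs_def vecs_def quad_form_def)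

text \<open>For real symmetric \<open>P\<close> and \<open>z = x + \<i> y\<close> with real \<open>x\<close>, \<open>y\<close>, the mixed term is twice the real part
  of a purely imaginary number, so the form of \<open>z\<close> is the sum of those of \<open>x\<close> and \<open>y\<close>.\<close>

lemma herm_pos_def_complexify:
  assumes K: "K = \<real> \<or> K = UNIV" and P: "P \<in> mats K" and pd: "herm_pos_def K P"
  shows "herm_pos_def UNIV P"
  using K
proof
  assume "K = UNIV" then show ?thesis using pd by simp
next
  assume KR: "K = \<real>"
  have herm: "conj_transpose P = P" using pd by (simp add: herm_pos_def_def)
  have real_pos: "0 < quad_form P y" if "y \<noteq> 0" "\<And>i. y $ i \<in> \<real>" for y
    using pd that KR by (auto simp: herm_pos_def_def nonzero_vecs_def vecs_def quad_form_def)
  have nonneg: "0 \<le> quad_form P y" if "\<And>i. y $ i \<in> \<real>" for y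
    using real_pos[OF _ that] by (cases "y = 0") (auto simp: less_imp_le)
  have "0 < quad_form P z" if "z \<noteq> 0" for z
  proof -
    define x where "x = (\<chi> i. complex_of_real (Re (z $ i)))"
    define y where "y = (\<chi> i. complex_of_real (Im (z $ i)))"
    have z: "z = x + \<i> *s y"
      by (simp add: x_def y_def vec_eq_iff complex_eq[symmetric])
    have xr: "x $ i \<in> \<real>" and yr: "y $ i \<in> \<real>" for i by (simp_all add: x_def y_def)
    have "cinner (P *v x) y \<in> \<real>"
      using P KR xr yr unfolding cinner_def matrix_vector_mult_def mats_def
      by (auto intro!: sum_in_Reals Reals_mult simp: Reals_cnj_iff[symmetric] complex_is_Real_iff)
    then have "Re (cinner (P *v x) (\<i> *s y)) = 0"
      by (simp add: cinner_scale_right complex_is_Real_iff)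
    then have q: "quad_form P z = quad_form P x + quad_form P y"
      unfolding z by (simp add: quad_form_add[OF herm] quad_form_scale)
    have "x \<noteq> 0 \<or> y \<noteq> 0" using that z by auto
    then show ?thesis
      using q real_pos[OF _ xr] real_pos[OF _ yr] nonneg[OF xr] nonneg[OF yr] by force
  qed
  then show ?thesis using herm by (simp add: herm_pos_def_UNIV_iff)
qed

lemma herm_pos_def_invertible:
  assumes "herm_pos_def UNIV P"
  shows "invertible P"
proof -
  have "x = 0" if "P *v x = 0" for x
    using assms that by (force simp: herm_pos_def_UNIV_iff quad_form_def)
  then show ?thesis
    by (metis invertible_left_inverse matrix_left_invertible_ker)
qed

lemma matrix_inv_cancel:
  fixes B :: "complex^'n^'n"
  assumes "invertible B"
  shows "B ** matrix_inv B = mat 1" "matrix_inv B ** B = mat 1"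
  using someI_ex[OF assms[unfolded invertible_def]] by (simp_all add: matrix_inv_def)

lemma matrix_inv_mult_vec:
  fixes B :: "complex^'n^'n"
  assumes "invertible B"
  shows "B *v (matrix_inv B *v x) = x" "matrix_inv B *v (B *v x) = x"
  using assms by (simp_all add: matrix_vector_mul_assoc matrix_inv_cancel)

lemma invertible_mult_vec_eq_0_iff:
  fixes B :: "complex^'n^'n"
  assumes "invertible B"
  shows "B *v x = 0 \<longleftrightarrow> x = 0"
  by (metis assms matrix_inv_mult_vec(2) matrix_vector_mult_0_right)

lemma conj_transpose_matrix_inv:
  assumes "invertible P" "conj_transpose P = P"
  shows "conj_transpose (matrix_inv P) = matrix_inv P"
proof -
  have "conj_transpose (P ** matrix_inv P) = mat 1"
    using assms by (simp add: matrix_inv_cancel(1) conj_transpose_def mat_def vec_eq_iff)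
  then have "conj_transpose (matrix_inv P) ** P = mat 1"
    using assms by (simp add: conj_transpose_mult)
  then show ?thesis
    by (metis assms(1) matrix_inv_cancel(1) matrix_mul_assoc matrix_mul_lid matrix_mul_rid)
qed

text \<open>\<open>\<langle>y, P y\<rangle>\<close> and \<open>\<langle>P y, y\<rangle>\<close> are conjugate, hence have the same real part.  This is used both
  for a Hermitian preconditioner and for the general matrix \<open>A\<close>.\<close>

lemma quad_form_matrix_inv:
  assumes "invertible P"
  shows "quad_form (matrix_inv P) (P *v y) = quad_form P y"
  unfolding quad_form_def matrix_inv_mult_vec(2)[OF assms]
  by (subst cinner_commute) simp

lemma herm_pos_def_matrix_inv:
  assumes "herm_pos_def UNIV P"
  shows "herm_pos_def UNIV (matrix_inv P)"
proof -
  note inv = herm_pos_def_invertible[OF assms]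
  have "0 < quad_form (matrix_inv P) z" if "z \<noteq> 0" for z
  proof -
    have "quad_form (matrix_inv P) z = quad_form P (matrix_inv P *v z)"
      using quad_form_matrix_inv[OF inv, of "matrix_inv P *v z"] by (simp add: matrix_inv_mult_vec inv)
    moreover have "matrix_inv P *v z \<noteq> 0"
      by (metis inv matrix_inv_mult_vec(1) matrix_vector_mult_0_right that)
    ultimately show ?thesis using assms by (simp add: herm_pos_def_UNIV_iff)
  qed
  then show ?thesis
    using assms inv by (simp add: herm_pos_def_UNIV_iff conj_transpose_matrix_inv)
qed

lemma quad_form_nonneg: "herm_pos_def UNIV P \<Longrightarrow> 0 \<le> quad_form P x"
  by (cases "x = 0") (auto simp: herm_pos_def_UNIV_iff less_imp_le)

lemma quad_form_pos: "herm_pos_def UNIV P \<Longrightarrow> x \<noteq> 0 \<Longrightarrow> 0 < quad_form P x"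
  by (auto simp: herm_pos_def_UNIV_iff)

lemma wnorm_power2: "herm_pos_def UNIV W \<Longrightarrow> (wnorm W x)\<^sup>2 = quad_form W x"
  using quad_form_nonneg[of W x] by (simp add: wnorm_def winner_def quad_form_def)

lemma wnorm_nonneg: "herm_pos_def UNIV W \<Longrightarrow> 0 \<le> wnorm W x"
  using quad_form_nonneg[of W x] by (simp add: wnorm_def winner_def quad_form_def)

text \<open>Pythagoras: the subtracted vector is the \<open>W\<close>-orthogonal projection of \<open>r\<close> onto the line
  spanned by \<open>q\<close>.  Both the Cauchy-Schwarz inequality and the gain of one step are read off.\<close>

lemma wnorm_minus_projection:
  assumes W: "herm_pos_def UNIV W" and q: "q \<noteq> 0"
  shows "(wnorm W (r - (winner W r q / winner W q q) *s q))\<^sup>2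
    = (wnorm W r)\<^sup>2 - (cmod (winner W q r))\<^sup>2 / (wnorm W q)\<^sup>2"
proof -
  define Q where "Q = quad_form W q"
  define s where "s = winner W r q"
  have herm: "conj_transpose W = W" using W by (simp add: herm_pos_def_UNIV_iff)
  have Q: "Q > 0" "winner W q q = of_real Q"
    using quad_form_pos[OF W q] cinner_hermitian_self_real[OF herm, of q] by (simp_all add: Q_def winner_def)
  have sym: "winner W q r = cnj s"
    unfolding s_def winner_def by (metis herm cinner_adjoint cinner_commute)
  have "quad_form W (r + (- (s / Q)) *s q)
      = quad_form W r + 2 * Re (cnj (- (s / Q)) * s) + (cmod (s / Q))\<^sup>2 * Q"
    unfolding quad_form_add[OF herm] quad_form_scale cinner_scale_right
    by (simp add: s_def winner_def Q_def)
  also have "Re (cnj (- (s / Q)) * s) = - ((cmod s)\<^sup>2 / Q)"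
    unfolding cmod_power2 by (simp add: power2_eq_square add_divide_distrib)
  also have "(cmod (s / Q))\<^sup>2 * Q = (cmod s)\<^sup>2 / Q"
    using Q by (simp add: norm_divide power_divide power2_eq_square)
  finally have "quad_form W (r - (s / Q) *s q) = quad_form W r - (cmod s)\<^sup>2 / Q"
    by simp
  then show ?thesis
    by (simp add: wnorm_power2[OF W] Q sym Q_def[symmetric] s_def[symmetric])
qed

lemma wnorm_Cauchy_Schwarz:
  assumes W: "herm_pos_def UNIV W"
  shows "(cmod (winner W q r))\<^sup>2 \<le> (wnorm W q)\<^sup>2 * (wnorm W r)\<^sup>2"
proof (cases "q = 0")
  case False
  have "0 \<le> (wnorm W r)\<^sup>2 - (cmod (winner W q r))\<^sup>2 / (wnorm W q)\<^sup>2"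
    using wnorm_minus_projection[OF W False, of r] by (metis zero_le_power2)
  then show ?thesis
    using quad_form_pos[OF W False] by (simp add: wnorm_power2[OF W] field_simps)
qed (simp add: winner_def)
section \<open>Finiteness of the set of eigenvalues\<close>

text \<open>Apply \<open>B - d\<close> to a vanishing combination: this removes the eigenvector for \<open>d\<close> and multiplies
  every other coefficient by the nonzero number \<open>c - d\<close>.\<close>

lemma eigenvectors_linearly_independent:
  fixes B :: "complex^'n^'n"
  assumes "finite F" and "\<And>c. c \<in> F \<Longrightarrow> v c \<noteq> 0 \<and> B *v v c = c *s v c"
    and "(\<Sum>c\<in>F. a c *s v c) = 0" and "c \<in> F"
  shows "a c = 0"
  using assms
proof (induction F arbitrary: a c rule: finite_induct)
  case (insert d F)
  have eq: "a d *s v d + (\<Sum>c\<in>F. a c *s v c) = 0"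
    using insert by simp
  have "B *v (a d *s v d + (\<Sum>c\<in>F. a c *s v c)) - d *s (a d *s v d + (\<Sum>c\<in>F. a c *s v c)) = 0"
    by (simp add: eq)
  moreover have "B *v (a d *s v d + (\<Sum>c\<in>F. a c *s v c))
     = (a d * d) *s v d + (\<Sum>c\<in>F. (a c * c) *s v c)"
    using insert.prems(1)
    by (simp add: matrix_vector_right_distrib vec.sum matrix_vector_mult_scale vector_smult_assoc)
  ultimately have "(\<Sum>c\<in>F. (a c * (c - d)) *s v c) = 0"
    by (simp add: vec_eq_iff algebra_simps sum_subtractf sum_distrib_left)
  then have "a c * (c - d) = 0" if "c \<in> F" for c
    using insert.IH[of "\<lambda>c. a c * (c - d)" c] insert.prems(1) that by auto
  then have z: "a c = 0" if "c \<in> F" for c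
    using that insert.hyps by fastforce
  then have "a d *s v d = 0" using eq by simp
  then have "a d = 0" using insert.prems(1)[of d] by (simp add: vec_eq_iff) blast
  then show ?case using z insert.prems by auto
qed simp

text \<open>\<open>Max\<close> and \<open>Min\<close> in the spectral radius and the condition number have their meaning only on
  finite sets.\<close>

lemma finite_eigenvalues: "finite (eigenvalues B)"
proof -
  have "\<exists>v. \<forall>c\<in>eigenvalues B. v c \<noteq> 0 \<and> B *v v c = c *s v c"
    unfolding eigenvalues_def by (rule bchoice) auto
  then obtain v where v: "\<And>c. c \<in> eigenvalues B \<Longrightarrow> v c \<noteq> 0 \<and> B *v v c = c *s v c"
    by blast
  have inj: "inj_on v (eigenvalues B)"
  proof (rule inj_onI)
    fix c d assume cd: "c \<in> eigenvalues B" "d \<in> eigenvalues B" "v c = v d"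
    then have "c *s v c = d *s v c" "v c \<noteq> 0" using v by metis+
    then show "c = d" by (simp add: vec_eq_iff) blast
  qed
  have "vec.independent (v ` eigenvalues B)"
  proof
    assume "vec.dependent (v ` eigenvalues B)"
    then obtain T u w where T: "finite T" "T \<subseteq> v ` eigenvalues B"
      "(\<Sum>x\<in>T. u x *s x) = 0" "w \<in> T" "u w \<noteq> 0"
      unfolding vec.dependent_explicit by blast
    then obtain F where F: "F \<subseteq> eigenvalues B" "T = v ` F"
      by (meson subset_imageE)
    have injF: "inj_on v F" using inj F(1) by (rule inj_on_subset)
    have "finite F" using T(1) F(2) injF by (simp add: finite_image_iff)
    moreover have "(\<Sum>c\<in>F. u (v c) *s v c) = 0"
      using T(3) unfolding F(2) by (simp add: sum.reindex[OF injF])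
    ultimately have "u (v c) = 0" if "c \<in> F" for c
      using eigenvectors_linearly_independent[of F v B "\<lambda>c. u (v c)" c] v F(1) that by blast
    then show False using T(4,5) F(2) by auto
  qed
  then have "finite (v ` eigenvalues B)"
    by (rule vec.finiteI_independent)
  then show ?thesis using inj by (simp add: finite_image_iff)
qed

section \<open>Rayleigh quotients and eigenvalues\<close>

text \<open>Moving from the minimizer \<open>v\<close> by \<open>- t G v\<close> changes the form by \<open>- 2 t \<parallel>G v\<parallel>\<^sup>2 + O(t\<^sup>2)\<close>, which
  would be negative for small \<open>t > 0\<close> unless \<open>G v = 0\<close>.\<close>

lemma semidefinite_form_zero_imp_kernel:
  assumes herm: "conj_transpose G = G" and nonneg: "\<And>x. 0 \<le> quad_form G x"
    and v: "quad_form G v = 0"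
  shows "G *v v = 0"
proof -
  define y where "y = G *v v"
  define p where "p = Re (cinner y y)"
  have p0: "p \<ge> 0" unfolding p_def Re_cinner_self by (simp add: sum_nonneg)
  have key: "0 \<le> - 2 * t * p + t\<^sup>2 * quad_form G y" for t :: real
  proof -
    have "0 \<le> quad_form G (v + complex_of_real (- t) *s y)" by (rule nonneg)
    also have "\<dots> = - 2 * t * p + t\<^sup>2 * quad_form G y"
      unfolding quad_form_add[OF herm] v quad_form_scale cinner_scale_right
      by (simp add: y_def[symmetric] p_def)
    finally show ?thesis .
  qed
  have "p = 0"
  proof (rule ccontr)
    assume "p \<noteq> 0"
    with p0 have p: "p > 0" by simp
    define g where "g = quad_form G y"
    have g: "g \<ge> 0" using nonneg g_def by simp
    \<comment> \<open>Any \<open>t > 0\<close> with \<open>t g < 2 p\<close> gives the contradiction; the \<open>1\<close> covers \<open>g = 0\<close>.\<close>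
    define t where "t = p / (g + 1)"
    have t: "t > 0" "t * (g + 1) = p" using p g by (simp_all add: t_def)
    have "0 \<le> t * (t * g - 2 * p)"
      using key[of t] by (simp add: g_def power2_eq_square algebra_simps)
    then have "2 * p \<le> t * g" using t(1) by (simp add: zero_le_mult_iff)
    then show False using t p by (simp add: algebra_simps)
  qed
  then show ?thesis by (simp add: p_def Re_cinner_self_eq_0_iff y_def)
qed

text \<open>Hermitian \<open>P B\<close> means that \<open>B\<close> is self-adjoint for the inner product given by \<open>P\<close>.  With \<open>\<mu>\<close>
  the maximum of the Rayleigh quotient, attained at \<open>v\<close> on the compact unit sphere, \<open>\<mu> P - P B\<close> is
  positive semidefinite and its form vanishes at \<open>v\<close>; hence \<open>P (\<mu> v - B v) = 0\<close>.\<close>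

lemma exists_eigenvalue_ge_rayleigh:
  fixes P B :: "complex^'n^'n"
  assumes P: "herm_pos_def UNIV P" and herm: "conj_transpose (P ** B) = P ** B"
  obtains \<mu> :: real where "complex_of_real \<mu> \<in> eigenvalues B"
    and "\<And>x. quad_form (P ** B) x \<le> \<mu> * quad_form P x"
proof -
  let ?f = "\<lambda>x. quad_form (P ** B) x / quad_form P x"
  have ne: "sphere (0::complex^'n) 1 \<noteq> {}" by simp
  have "continuous_on (sphere 0 1) ?f"
  proof (intro continuous_on_divide continuous_on_quad_form ballI)
    fix x :: "complex^'n" assume "x \<in> sphere 0 1"
    then have "x \<noteq> 0" by auto
    then show "quad_form P x \<noteq> 0" using quad_form_pos[OF P, of x] by simp
  qed
  from continuous_attains_sup[OF compact_sphere ne this]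
  obtain v where v: "v \<in> sphere 0 1" "\<And>y. y \<in> sphere 0 1 \<Longrightarrow> ?f y \<le> ?f v"
    by blast
  define \<mu> where "\<mu> = ?f v"
  have v0: "v \<noteq> 0" using v(1) by auto
  have bound: "quad_form (P ** B) x \<le> \<mu> * quad_form P x" for x
  proof (cases "x = 0")
    case False
    define c where "c = complex_of_real (1 / norm x)"
    have c: "cmod c \<noteq> 0" using False by (simp add: c_def)
    have "c *s x = (1 / norm x) *\<^sub>R x"
      unfolding vec_eq_iff vector_smult_component vector_scaleR_component
      by (simp add: c_def scaleR_conv_of_real)
    then have "c *s x \<in> sphere 0 1" using False by simp
    then have "?f (c *s x) \<le> \<mu>" using v(2) \<mu>_def by blast
    then have "?f x \<le> \<mu>" using c by (simp add: quad_form_scale)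
    then show ?thesis using quad_form_pos[OF P False] by (simp add: field_simps)
  qed simp
  define G where "G = (\<chi> i j. complex_of_real \<mu> * P $ i $ j - (P ** B) $ i $ j)"
  have G_mult: "G *v x = complex_of_real \<mu> *s (P *v x) - (P ** B) *v x" for x
    by (simp add: G_def matrix_vector_mult_def vec_eq_iff algebra_simps sum_subtractf sum_distrib_left)
  have G_form: "quad_form G x = \<mu> * quad_form P x - quad_form (P ** B) x" for x
    by (simp add: quad_form_def G_mult cinner_diff_left cinner_scale_left)
  have P_herm: "conj_transpose P = P" using P by (simp add: herm_pos_def_UNIV_iff)
  have "conj_transpose G = G"
  proof -
    have "cnj (P $ j $ i) = P $ i $ j" "cnj ((P ** B) $ j $ i) = (P ** B) $ i $ j" for i j
      using arg_cong[OF P_herm, of "\<lambda>X. X $ i $ j"] arg_cong[OF herm, of "\<lambda>X. X $ i $ j"]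
      by (simp_all add: conj_transpose_def)
    then show ?thesis by (simp add: G_def conj_transpose_def vec_eq_iff)
  qed
  moreover have "0 \<le> quad_form G x" for x using bound by (simp add: G_form)
  moreover have "quad_form G v = 0"
    using quad_form_pos[OF P v0] by (simp add: G_form \<mu>_def)
  ultimately have "G *v v = 0" by (rule semidefinite_form_zero_imp_kernel)
  then have "P *v (complex_of_real \<mu> *s v - B *v v) = 0"
    by (simp add: G_mult matrix_vector_mult_diff_distrib matrix_vector_mult_scale matrix_vector_mul_assoc)
  then have "B *v v = complex_of_real \<mu> *s v"
    using invertible_mult_vec_eq_0_iff[OF herm_pos_def_invertible[OF P]] by auto
  then have "complex_of_real \<mu> \<in> eigenvalues B"
    using v0 by (auto simp: eigenvalues_def)
  then show thesis using bound that by blast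
qed

lemma matrix_vector_mult_uminus: "(- B) *v x = - (B *v x)" for B :: "complex^'n^'n"
  by (simp add: matrix_vector_mult_def vec_eq_iff sum_negf)

lemma quad_form_uminus: "quad_form (- B) x = - quad_form B x"
  using cinner_diff_left[of 0 "B *v x" x] by (simp add: quad_form_def matrix_vector_mult_uminus)

lemma matrix_mult_uminus_right: "P ** (- B) = - (P ** B)" for P :: "complex^'n^'n"
  by (simp add: matrix_matrix_mult_def vec_eq_iff sum_negf)

lemma rayleigh_le_Max_eigenvalue:
  assumes P: "herm_pos_def UNIV P" and herm: "conj_transpose (P ** B) = P ** B"
  shows "quad_form (P ** B) x \<le> Max (Re ` eigenvalues B) * quad_form P x"
proof -
  obtain \<mu> where \<mu>: "complex_of_real \<mu> \<in> eigenvalues B"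
    "\<And>x. quad_form (P ** B) x \<le> \<mu> * quad_form P x"
    using exists_eigenvalue_ge_rayleigh[OF assms] by blast
  have "\<mu> \<le> Max (Re ` eigenvalues B)"
    using \<mu>(1) finite_eigenvalues by (intro Max_ge) (auto intro: rev_image_eqI)
  then show ?thesis
    using \<mu>(2)[of x] mult_right_mono[OF _ quad_form_nonneg[OF P]] by (meson order_trans)
qed

lemma rayleigh_ge_Min_eigenvalue:
  assumes P: "herm_pos_def UNIV P" and herm: "conj_transpose (P ** B) = P ** B"
  shows "Min (Re ` eigenvalues B) * quad_form P x \<le> quad_form (P ** B) x"
proof -
  have "conj_transpose (P ** (- B)) = P ** (- B)"
    using herm by (simp add: matrix_mult_uminus_right conj_transpose_uminus)
  then obtain \<mu> where \<mu>: "complex_of_real \<mu> \<in> eigenvalues (- B)"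
    "\<And>x. quad_form (P ** (- B)) x \<le> \<mu> * quad_form P x"
    using exists_eigenvalue_ge_rayleigh[OF P] by blast
  obtain v where "v \<noteq> 0" "- (B *v v) = complex_of_real \<mu> *s v"
    using \<mu>(1) by (auto simp: eigenvalues_def matrix_vector_mult_uminus)
  moreover from this have "B *v v = - (complex_of_real \<mu> *s v)"
    by (metis minus_minus)
  ultimately have "v \<noteq> 0" "B *v v = complex_of_real (- \<mu>) *s v"
    by (simp_all add: vec_eq_iff)
  then have "complex_of_real (- \<mu>) \<in> eigenvalues B"
    unfolding eigenvalues_def by blast
  then have "Min (Re ` eigenvalues B) \<le> - \<mu>"
    using finite_eigenvalues by (intro Min_le) (auto intro: rev_image_eqI)
  then have "Min (Re ` eigenvalues B) * quad_form P x \<le> - \<mu> * quad_form P x"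
    by (rule mult_right_mono[OF _ quad_form_nonneg[OF P]])
  then show ?thesis
    using \<mu>(2)[of x] by (simp add: matrix_mult_uminus_right quad_form_uminus)
qed

text \<open>On an eigenvector \<open>v\<close> the operator \<open>B\<^sup>2 + s\<^sup>2 = (B - \<i> s) (B + \<i> s)\<close> vanishes.  So either
  \<open>(B + \<i> s) v = 0\<close>, or \<open>(B + \<i> s) v\<close> is an eigenvector for \<open>\<i> s\<close>.\<close>

lemma eigenvalue_modulus_of_minus_square:
  assumes "complex_of_real (s\<^sup>2) \<in> eigenvalues (- (B ** B))"
  shows "\<exists>c\<in>eigenvalues B. cmod c = \<bar>s\<bar>"
proof -
  obtain v where v: "v \<noteq> 0" "- (B *v (B *v v)) = complex_of_real (s\<^sup>2) *s v"
    using assms by (auto simp: eigenvalues_def matrix_vector_mult_uminus matrix_vector_mul_assoc)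
  define c where "c = \<i> * complex_of_real s"
  have c: "cmod c = \<bar>s\<bar>" "c * c = - complex_of_real (s\<^sup>2)"
    by (simp_all add: c_def norm_mult power2_eq_square complex_eq_iff)
  have BB: "B *v (B *v v) = (c * c) *s v"
    using v(2) unfolding c by (simp add: vec_eq_iff minus_equation_iff) (metis minus_minus)
  define w where "w = B *v v + c *s v"
  show ?thesis
  proof (cases "w = 0")
    case True
    then have "B *v v = (- c) *s v" by (simp add: w_def eq_neg_iff_add_eq_0)
    then have "- c \<in> eigenvalues B" using v(1) by (auto simp: eigenvalues_def)
    then show ?thesis using c(1) by (metis norm_minus_cancel)
  next
    case False
    have "B *v w = c *s w"
      unfolding w_def matrix_vector_right_distrib matrix_vector_mult_scale BB
        vector_add_ldistrib vector_smult_assoc by (rule add.commute)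
    then have "c \<in> eigenvalues B" using False by (auto simp: eigenvalues_def)
    then show ?thesis using c by blast
  qed
qed

text \<open>As \<open>B\<close> is skew-adjoint for \<open>P\<close>, \<open>\<langle>P B x, B x\<rangle> = \<langle>P (- B\<^sup>2) x, x\<rangle>\<close> and \<open>- B\<^sup>2\<close> is self-adjoint,
  so its largest eigenvalue \<open>\<mu>\<close> bounds the quotient; \<open>\<mu>\<close> is the squared modulus of an eigenvalue
  of \<open>B\<close>.\<close>

lemma skew_adjoint_norm_le_spectral_radius:
  assumes P: "herm_pos_def UNIV P" and skew: "conj_transpose (P ** B) = - (P ** B)"
  shows "quad_form P (B *v x) \<le> (spectral_radius B)\<^sup>2 * quad_form P x"
proof -
  have P_herm: "conj_transpose P = P" using P by (simp add: herm_pos_def_UNIV_iff)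
  have BP: "conj_transpose B ** P = - (P ** B)"
    using skew by (simp add: conj_transpose_mult P_herm)
  have gram: "P ** (- (B ** B)) = conj_transpose B ** P ** B"
    unfolding BP by (simp add: matrix_mult_uminus_right matrix_mul_assoc)
      (simp add: matrix_matrix_mult_def vec_eq_iff sum_negf)
  have form: "quad_form (P ** (- (B ** B))) x = quad_form P (B *v x)" for x
    unfolding gram quad_form_def
    by (simp add: cinner_adjoint[of "conj_transpose B"] matrix_vector_mul_assoc[symmetric])
  have "conj_transpose (P ** (- (B ** B))) = P ** (- (B ** B))"
    unfolding gram by (simp add: conj_transpose_mult P_herm matrix_mul_assoc)
  then obtain \<mu> where \<mu>: "complex_of_real \<mu> \<in> eigenvalues (- (B ** B))"
    "\<And>x. quad_form (P ** (- (B ** B))) x \<le> \<mu> * quad_form P x"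
    using exists_eigenvalue_ge_rayleigh[OF P] by blast
  have "\<mu> \<ge> 0"
  proof -
    have "0 \<le> \<mu> * quad_form P 1"
      using \<mu>(2)[of 1] quad_form_nonneg[OF P, of "B *v 1"] unfolding form by linarith
    moreover have "quad_form P 1 > 0" by (rule quad_form_pos[OF P]) simp
    ultimately show ?thesis by (simp add: zero_le_mult_iff)
  qed
  then obtain c where c: "c \<in> eigenvalues B" "cmod c = sqrt \<mu>"
    using eigenvalue_modulus_of_minus_square[of "sqrt \<mu>" B] \<mu>(1) by auto
  have "sqrt \<mu> \<le> spectral_radius B"
    unfolding spectral_radius_def c(2)[symmetric]
    using c(1) finite_eigenvalues by (intro Max_ge) auto
  then have "\<mu> \<le> (spectral_radius B)\<^sup>2"
    by (rule sqrt_le_D)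
  then have "\<mu> * quad_form P x \<le> (spectral_radius B)\<^sup>2 * quad_form P x"
    by (rule mult_right_mono[OF _ quad_form_nonneg[OF P]])
  then show ?thesis using \<mu>(2)[of x] unfolding form by linarith
qed
section \<open>One GMRES step\<close>

text \<open>The optimal step length must be an admissible scalar, which for real data requires that no
  operation leaves the reals.\<close>

lemma field_closed:
  assumes K: "K = \<real> \<or> K = (UNIV :: complex set)"
  shows "0 \<in> K" "1 \<in> K"
    and "a \<in> K \<Longrightarrow> b \<in> K \<Longrightarrow> a + b \<in> K" "a \<in> K \<Longrightarrow> b \<in> K \<Longrightarrow> a - b \<in> K"
    and "a \<in> K \<Longrightarrow> b \<in> K \<Longrightarrow> a * b \<in> K" "a \<in> K \<Longrightarrow> b \<in> K \<Longrightarrow> a / b \<in> K"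
    and "a \<in> K \<Longrightarrow> cnj a \<in> K"
    and "(\<And>i. i \<in> I \<Longrightarrow> f i \<in> K) \<Longrightarrow> sum f I \<in> K"
  using K by (auto intro!: sum_in_Reals simp: Reals_cnj_iff)

lemma vecs_closed:
  assumes K: "K = \<real> \<or> K = UNIV"
  shows "x \<in> vecs K \<Longrightarrow> y \<in> vecs K \<Longrightarrow> x - y \<in> vecs K"
    and "B \<in> mats K \<Longrightarrow> x \<in> vecs K \<Longrightarrow> B *v x \<in> vecs K"
    and "x \<in> vecs K \<Longrightarrow> y \<in> vecs K \<Longrightarrow> cinner x y \<in> K"
  by (auto simp: vecs_def mats_def matrix_vector_mult_def cinner_def intro!: field_closed[OF K])

lemma herm_part_mats:
  assumes K: "K = \<real> \<or> K = UNIV" and "A \<in> mats K"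
  shows "herm_part A \<in> mats K"
  using assms(2) K by (auto simp: mats_def herm_part_def conj_transpose_def intro!: field_closed[OF K])

lemma nonzero_vecs_nonempty:
  assumes K: "K = \<real> \<or> K = UNIV"
  shows "nonzero_vecs K \<noteq> ({} :: (complex^'n) set)"
proof -
  have "(1 :: complex^'n) \<in> nonzero_vecs K"
    by (simp add: nonzero_vecs_def vecs_def field_closed[OF K])
  then show ?thesis by blast
qed

lemma funpow_matrix_combination:
  fixes B :: "complex^'n^'n"
  shows "B *v (\<Sum>j\<in>J. c j *s (((*v) B ^^ j) v)) = (\<Sum>j\<in>J. c j *s (((*v) B ^^ Suc j) v))"
  by (simp add: vec.sum matrix_vector_mult_scale)

text \<open>
  This is used with \<open>B = H A\<close> and \<open>v = H r\<^sub>0\<close>.  For \<open>r\<^sub>i = r\<^sub>0 - A k\<close> with \<open>k \<in> K\<^sub>i\<close>, the preconditioned residual is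
  \<open>H r\<^sub>i = H r\<^sub>0 - (H A) k\<close>, which lies in \<open>K\<^sub>i\<^sub>+\<^sub>1\<close>.  Hence moving from the \<open>i\<close>-th iterate along
  \<open>H r\<^sub>i\<close> stays inside the next search space.
\<close>

lemma krylov_step:
  assumes K: "K = \<real> \<or> K = UNIV" and k: "k \<in> krylov K B v i" and a: "a \<in> K"
  shows "k + a *s (v - B *v k) \<in> krylov K B v (Suc i)"
proof -
  obtain c where c: "k = (\<Sum>j<i. c j *s (((*v) B ^^ j) v))" "\<forall>j<i. c j \<in> K"
    using k unfolding krylov_def by blast
  \<comment> \<open>The coefficient of \<open>B\<^sup>j v\<close>: one part from \<open>k\<close>, one from \<open>a (v - B k)\<close> after an index shift.\<close>
  define d where "d j = (if j < i then c j else 0) + (case j of 0 \<Rightarrow> a | Suc m \<Rightarrow> - (a * c m))" for j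
  have dK: "\<forall>j<Suc i. d j \<in> K"
    using c(2) a field_closed[OF K] K by (auto simp: d_def split: nat.split)
  have "(\<Sum>j<Suc i. d j *s (((*v) B ^^ j) v))
      = (\<Sum>j<Suc i. (if j < i then c j else 0) *s (((*v) B ^^ j) v))
        + (\<Sum>j<Suc i. (case j of 0 \<Rightarrow> a | Suc m \<Rightarrow> - (a * c m)) *s (((*v) B ^^ j) v))"
    by (simp only: d_def vector_sadd_rdistrib sum.distrib)
  also have "(\<Sum>j<Suc i. (if j < i then c j else 0) *s (((*v) B ^^ j) v)) = k"
    by (simp add: c(1))
  also have "(\<Sum>j<Suc i. (case j of 0 \<Rightarrow> a | Suc m \<Rightarrow> - (a * c m)) *s (((*v) B ^^ j) v))
      = a *s v + (\<Sum>m<i. (- (a * c m)) *s (((*v) B ^^ Suc m) v))"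
    by (simp only: sum.lessThan_Suc_shift) simp
  also have "\<dots> = a *s v - a *s (B *v k)"
    unfolding c(1) funpow_matrix_combination
    by (simp add: vec_eq_iff sum_negf sum_distrib_left mult.assoc)
  also have "k + \<dots> = k + a *s (v - B *v k)"
    by (simp add: vec_eq_iff algebra_simps)
  finally have "k + a *s (v - B *v k) = (\<Sum>j<Suc i. d j *s (((*v) B ^^ j) v))"
    by (rule sym)
  then show ?thesis
    unfolding krylov_def mem_Collect_eq using dK by (intro exI[of _ d] conjI)
qed

lemma krylov_vecs:
  assumes K: "K = \<real> \<or> K = UNIV" and B: "B \<in> mats K" and v: "v \<in> vecs K"
    and k: "k \<in> krylov K B v i"
  shows "k \<in> vecs K"
proof -
  obtain c where c: "k = (\<Sum>j<i. c j *s (((*v) B ^^ j) v))" "\<forall>j<i. c j \<in> K"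
    using k unfolding krylov_def by blast
  have "((*v) B ^^ j) v \<in> vecs K" for j
    by (induction j) (auto intro: v vecs_closed(2)[OF K B])
  then show ?thesis
    using c by (auto simp: vecs_def intro!: field_closed[OF K])
qed

definition field_of_values_quotient ::
  "complex^'n^'n \<Rightarrow> complex^'n^'n \<Rightarrow> complex^'n \<Rightarrow> real" where
  "field_of_values_quotient W B y
     = (cmod (winner W (B *v y) y))\<^sup>2 / ((wnorm W (B *v y))\<^sup>2 * (wnorm W y)\<^sup>2)"

lemma field_of_values_quotient_bounds:
  assumes W: "herm_pos_def UNIV W"
  shows "0 \<le> field_of_values_quotient W B y" "field_of_values_quotient W B y \<le> 1"
  using wnorm_Cauchy_Schwarz[OF W, of "B *v y" y]
  by (auto simp: field_of_values_quotient_def divide_le_eq_1 zero_less_mult_iff not_less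
      intro!: divide_nonneg_nonneg)

lemma INF_quotient_bounds:
  fixes B :: "complex^'n^'n"
  assumes W: "herm_pos_def UNIV W"
  shows "y \<in> Y \<Longrightarrow> (INF y\<in>Y. field_of_values_quotient W B y) \<le> field_of_values_quotient W B y"
    and "Y \<noteq> {} \<Longrightarrow> (INF y\<in>Y. field_of_values_quotient W B y) \<le> 1"
proof -
  have bdd: "bdd_below (field_of_values_quotient W B ` Y)"
    using field_of_values_quotient_bounds(1)[OF W] by (intro bdd_belowI2)
  show *: "(INF y\<in>Y. field_of_values_quotient W B y) \<le> field_of_values_quotient W B y"
    if "y \<in> Y" for y
    by (rule cINF_lower[OF bdd that])
  show "(INF y\<in>Y. field_of_values_quotient W B y) \<le> 1" if "Y \<noteq> {}"
    using * field_of_values_quotient_bounds(2)[OF W] that by (meson all_not_in_conv order_trans)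
qed

lemma wnorm_optimal_step:
  assumes W: "herm_pos_def UNIV W" and r: "r \<noteq> 0" and q: "B *v r \<noteq> 0"
  shows "(wnorm W (r - (winner W r (B *v r) / winner W (B *v r) (B *v r)) *s (B *v r)))\<^sup>2
    = (1 - field_of_values_quotient W B r) * (wnorm W r)\<^sup>2"
  unfolding wnorm_minus_projection[OF W q]
  using quad_form_pos[OF W r] quad_form_pos[OF W q]
  by (simp add: field_of_values_quotient_def wnorm_power2[OF W] field_simps)

text \<open>The next iterate is compared with the optimal step along \<open>H r\<close>.  Once \<open>r = 0\<close> that step has no
  meaning, and the comparison is with the step of length \<open>0\<close>.\<close>

lemma wp_gmres_residual_step:
  fixes A H W :: "complex^'n^'n"
  assumes K: "K = \<real> \<or> K = UNIV" and mats: "A \<in> mats K" "H \<in> mats K" "W \<in> mats K"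
    and inv: "invertible A" "invertible H" and W: "herm_pos_def UNIV W"
    and vecs: "b \<in> vecs K" "x0 \<in> vecs K"
    and x: "wp_gmres_iterate K A H W b x0 i x" and x': "wp_gmres_iterate K A H W b x0 (Suc i) x'"
  shows "wnorm W (b - A *v x')
    \<le> sqrt (1 - (INF y\<in>nonzero_vecs K. field_of_values_quotient W (A ** H) y)) * wnorm W (b - A *v x)"
proof -
  define \<theta> where "\<theta> = 1 - (INF y\<in>nonzero_vecs K. field_of_values_quotient W (A ** H) y)"
  define r where "r = b - A *v x"
  define r0 where "r0 = b - A *v x0"
  obtain k where k: "x = x0 + k" "k \<in> krylov K (H ** A) (H *v r0) i"
    using x unfolding wp_gmres_iterate_def is_arg_min_def r0_def by blast
  have r0K: "r0 \<in> vecs K" unfolding r0_def by (intro vecs_closed[OF K] vecs mats)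
  have HA: "H ** A \<in> mats K"
    using mats by (auto simp: mats_def matrix_matrix_mult_def intro!: field_closed[OF K])
  have kK: "k \<in> vecs K"
    using krylov_vecs[OF K HA _ k(2)] vecs_closed(2)[OF K mats(2) r0K] .
  have r_eq: "r = r0 - A *v k"
    by (simp add: r_def r0_def k(1) matrix_vector_right_distrib)
  have rK: "r \<in> vecs K" unfolding r_eq by (intro vecs_closed[OF K] r0K mats kK)
  have Hr: "H *v r0 - (H ** A) *v k = H *v r"
    by (simp add: r_eq matrix_vector_mult_diff_distrib matrix_vector_mul_assoc)
  have opt: "wnorm W (b - A *v x') \<le> wnorm W (r - a *s ((A ** H) *v r))" if a: "a \<in> K" for a
  proof -
    have "x0 + (k + a *s (H *v r)) \<in> (+) x0 ` krylov K (H ** A) (H *v r0) (Suc i)"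
      using krylov_step[OF K k(2) a] unfolding Hr by (rule imageI)
    then have "wnorm W (b - A *v x') \<le> wnorm W (b - A *v (x0 + (k + a *s (H *v r))))"
      using x' unfolding wp_gmres_iterate_def is_arg_min_linorder r0_def by blast
    also have "b - A *v (x0 + (k + a *s (H *v r))) = r - a *s ((A ** H) *v r)"
      by (simp add: r_def k(1) matrix_vector_right_distrib matrix_vector_mult_scale
          matrix_vector_mul_assoc)
    finally show ?thesis .
  qed
  have "wnorm W (b - A *v x') \<le> sqrt \<theta> * wnorm W r"
  proof (cases "r = 0")
    case True
    then show ?thesis using opt[of 0] field_closed[OF K] by simp (simp add: wnorm_def winner_def)
  next
    case False
    define q where "q = (A ** H) *v r"
    have q: "q \<noteq> 0"
      using False inv by (simp add: q_def matrix_vector_mul_assoc[symmetric] invertible_mult_vec_eq_0_iff)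
    have "A *v (H *v r) \<in> vecs K" by (intro vecs_closed[OF K] mats rK)
    then have qK: "q \<in> vecs K" by (simp add: q_def matrix_vector_mul_assoc)
    have "winner W r q / winner W q q \<in> K"
      unfolding winner_def by (intro field_closed[OF K] vecs_closed[OF K] mats qK rK)
    from opt[OF this] have "(wnorm W (b - A *v x'))\<^sup>2 \<le> (1 - field_of_values_quotient W (A ** H) r) * (wnorm W r)\<^sup>2"
      using wnorm_optimal_step[OF W False, of "A ** H"] q wnorm_nonneg[OF W]
      unfolding q_def by (metis power_mono)
    also have "\<dots> \<le> \<theta> * (wnorm W r)\<^sup>2"
      unfolding \<theta>_def using False rK
      by (intro mult_right_mono diff_left_mono INF_quotient_bounds[OF W]) (auto simp: nonzero_vecs_def)
    finally have "sqrt ((wnorm W (b - A *v x'))\<^sup>2) \<le> sqrt (\<theta> * (wnorm W r)\<^sup>2)"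
      by (rule real_sqrt_le_mono)
    then show ?thesis using wnorm_nonneg[OF W] by (simp add: real_sqrt_mult)
  qed
  then show ?thesis by (simp add: \<theta>_def r_def)
qed

lemma gmres_bound1_alt:
  "gmres_bound1 K A H W i
    = sqrt (1 - (INF y\<in>nonzero_vecs K. field_of_values_quotient W (A ** H) y)) ^ i"
  by (simp add: gmres_bound1_def half_power_def field_of_values_quotient_def)

lemma wp_gmres_residual_le_bound1:
  fixes A H W :: "complex^'n^'n"
  assumes K: "K = \<real> \<or> K = UNIV" and mats: "A \<in> mats K" "H \<in> mats K" "W \<in> mats K"
    and inv: "invertible A" "invertible H" and W: "herm_pos_def UNIV W"
    and vecs: "b \<in> vecs K" "x0 \<in> vecs K"
    and x: "\<And>i. wp_gmres_iterate K A H W b x0 i (x i)"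
  shows "wnorm W (b - A *v x i) \<le> gmres_bound1 K A H W i * wnorm W (b - A *v x0)"
  unfolding gmres_bound1_alt
proof (induction i)
  case 0
  have "x 0 = x0"
    using x[of 0] by (simp add: wp_gmres_iterate_def is_arg_min_def krylov_def)
  then show ?case by simp
next
  case (Suc i)
  let ?s = "sqrt (1 - (INF y\<in>nonzero_vecs K. field_of_values_quotient W (A ** H) y))"
  have "0 \<le> ?s"
    using INF_quotient_bounds(2)[OF W nonzero_vecs_nonempty[OF K]] by simp
  then have "?s * wnorm W (b - A *v x i) \<le> ?s * (?s ^ i * wnorm W (b - A *v x0))"
    using Suc.IH by (rule mult_left_mono[rotated])
  then show ?case
    using wp_gmres_residual_step[OF K mats inv W vecs x[of i] x[of "Suc i"]]
    by (simp add: mult.assoc)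
qed

section \<open>The bounds for a Hermitian positive definite preconditioner\<close>

text \<open>\<open>sqrt\<close> is an odd function on the reals, so monotonicity requires a nonnegative smaller base; each
  application has to show that the infimum in question is at most \<open>1\<close>.\<close>

lemma half_power_mono:
  assumes "0 \<le> s" "s \<le> t"
  shows "half_power s i \<le> half_power t i"
  unfolding half_power_def using assms by (intro power_mono) auto

lemma cmod_herm_part_form: "cmod (cinner (herm_part B *v y) y) = \<bar>quad_form B y\<bar>"
  by (simp add: cinner_herm_part)

text \<open>The two infima of the second bound.  They are written with the forms of \<open>A\<^sup>-\<^sup>1\<close> and \<open>A\<close>, whose
  real parts are already the forms of the Hermitian parts.\<close>

definition inverse_coercivity :: "complex set \<Rightarrow> complex^'n^'n \<Rightarrow> complex^'n^'n \<Rightarrow> real" where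
  "inverse_coercivity K A H = (INF y\<in>nonzero_vecs K. \<bar>quad_form (matrix_inv A) y\<bar> / quad_form H y)"

definition coercivity :: "complex set \<Rightarrow> complex^'n^'n \<Rightarrow> complex^'n^'n \<Rightarrow> real" where
  "coercivity K A H = (INF y\<in>nonzero_vecs K. \<bar>quad_form A y\<bar> / quad_form (matrix_inv H) y)"

lemma gmres_bound2_alt:
  "gmres_bound2 K A H i = half_power (1 - inverse_coercivity K A H * coercivity K A H) i"
  by (simp only: gmres_bound2_def inverse_coercivity_def coercivity_def cmod_herm_part_form
      quad_form_def[of H, symmetric] quad_form_def[of "matrix_inv H", symmetric])

lemma INF_abs_form_bounds:
  assumes P: "herm_pos_def UNIV P"
  shows "z \<in> Y \<Longrightarrow> (INF y\<in>Y. \<bar>quad_form B y\<bar> / quad_form P y) \<le> \<bar>quad_form B z\<bar> / quad_form P z"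
    and "Y \<noteq> {} \<Longrightarrow> 0 \<le> (INF y\<in>Y. \<bar>quad_form B y\<bar> / quad_form P y)"
proof -
  have nonneg: "0 \<le> \<bar>quad_form B y\<bar> / quad_form P y" for y
    using quad_form_nonneg[OF P] by simp
  then have bdd: "bdd_below ((\<lambda>y. \<bar>quad_form B y\<bar> / quad_form P y) ` Y)"
    by (intro bdd_belowI2)
  show "(INF y\<in>Y. \<bar>quad_form B y\<bar> / quad_form P y) \<le> \<bar>quad_form B z\<bar> / quad_form P z" if "z \<in> Y"
    by (rule cINF_lower[OF bdd that])
  show "0 \<le> (INF y\<in>Y. \<bar>quad_form B y\<bar> / quad_form P y)" if "Y \<noteq> {}"
    by (rule cINF_greatest[OF that nonneg])
qed

text \<open>In terms of \<open>z\<close>, the numerator is \<open>\<bar>\<langle>A z, z\<rangle>\<bar>\<^sup>2\<close>.  Each of its two factors is at least the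
  modulus of its real part, and one of these is rewritten as the form of \<open>A\<^sup>-\<^sup>1\<close> at \<open>A z\<close>.\<close>

lemma field_of_values_quotient_split:
  fixes A H :: "complex^'n^'n"
  assumes H: "herm_pos_def UNIV H" and A: "invertible A" and y: "y \<noteq> 0"
  defines "z \<equiv> H *v y"
  shows "field_of_values_quotient H (A ** H) y
    \<ge> (\<bar>quad_form (matrix_inv A) (A *v z)\<bar> / quad_form H (A *v z))
      * (\<bar>quad_form A z\<bar> / quad_form (matrix_inv H) z)"
proof -
  note Hinv = herm_pos_def_invertible[OF H]
  have herm: "conj_transpose H = H" using H by (simp add: herm_pos_def_UNIV_iff)
  have AH: "(A ** H) *v y = A *v z" by (simp add: z_def matrix_vector_mul_assoc)
  have num: "winner H (A *v z) y = cinner (A *v z) z"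
    unfolding winner_def z_def by (metis cinner_adjoint herm)
  have den: "(wnorm H y)\<^sup>2 = quad_form (matrix_inv H) z"
    unfolding z_def quad_form_matrix_inv[OF Hinv] wnorm_power2[OF H] by simp
  have inv_form: "quad_form (matrix_inv A) (A *v z) = quad_form A z"
    by (rule quad_form_matrix_inv[OF A])
  have "\<bar>quad_form A z\<bar> * \<bar>quad_form A z\<bar> \<le> (cmod (cinner (A *v z) z))\<^sup>2"
    unfolding power2_eq_square quad_form_def by (intro mult_mono abs_Re_le_cmod) auto
  then have "(\<bar>quad_form A z\<bar> * \<bar>quad_form A z\<bar>) / (quad_form H (A *v z) * quad_form (matrix_inv H) z)
      \<le> (cmod (cinner (A *v z) z))\<^sup>2 / (quad_form H (A *v z) * quad_form (matrix_inv H) z)"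
    using quad_form_nonneg[OF H] quad_form_nonneg[OF herm_pos_def_matrix_inv[OF H]]
    by (intro divide_right_mono mult_nonneg_nonneg)
  then show ?thesis
    by (simp add: field_of_values_quotient_def AH num den inv_form wnorm_power2[OF H, of "A *v z"])
qed

lemma coercivity_product_le_INF_quotient:
  fixes A H :: "complex^'n^'n"
  assumes K: "K = \<real> \<or> K = UNIV" and mats: "A \<in> mats K" "H \<in> mats K"
    and A: "invertible A" and H: "herm_pos_def UNIV H"
  shows "inverse_coercivity K A H * coercivity K A H
    \<le> (INF y\<in>nonzero_vecs K. field_of_values_quotient H (A ** H) y)"
proof (rule cINF_greatest[OF nonzero_vecs_nonempty[OF K]])
  fix y :: "complex^'n" assume y: "y \<in> nonzero_vecs K"
  note Hi = herm_pos_def_matrix_inv[OF H]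
  define z where "z = H *v y"
  have z: "z \<in> nonzero_vecs K" and w: "A *v z \<in> nonzero_vecs K"
    using y A herm_pos_def_invertible[OF H]
    by (auto simp: z_def nonzero_vecs_def invertible_mult_vec_eq_0_iff intro!: vecs_closed[OF K] mats)
  have "inverse_coercivity K A H * coercivity K A H
      \<le> (\<bar>quad_form (matrix_inv A) (A *v z)\<bar> / quad_form H (A *v z))
        * (\<bar>quad_form A z\<bar> / quad_form (matrix_inv H) z)"
    unfolding inverse_coercivity_def coercivity_def
    using quad_form_nonneg[OF H] nonzero_vecs_nonempty[OF K]
    by (intro mult_mono INF_abs_form_bounds(1)[OF H w] INF_abs_form_bounds(1)[OF Hi z]
        INF_abs_form_bounds(2)[OF Hi]) auto
  also have "\<dots> \<le> field_of_values_quotient H (A ** H) y"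
    unfolding z_def using y by (intro field_of_values_quotient_split[OF H A]) (auto simp: nonzero_vecs_def)
  finally show "inverse_coercivity K A H * coercivity K A H \<le> field_of_values_quotient H (A ** H) y" .
qed

lemma gmres_bound1_le_bound2:
  fixes A H :: "complex^'n^'n"
  assumes K: "K = \<real> \<or> K = UNIV" and mats: "A \<in> mats K" "H \<in> mats K"
    and A: "invertible A" and H: "herm_pos_def UNIV H"
  shows "gmres_bound1 K A H H i \<le> gmres_bound2 K A H i"
  unfolding gmres_bound1_alt gmres_bound2_alt half_power_def[symmetric]
  using INF_quotient_bounds(2)[OF H nonzero_vecs_nonempty[OF K], of "A ** H"]
    coercivity_product_le_INF_quotient[OF assms]
  by (intro half_power_mono) auto

section \<open>The spectral bound\<close>

text \<open>\<open>H M\<close> is self-adjoint for the inner product of \<open>H\<^sup>-\<^sup>1\<close>, where its form is that of \<open>M\<close>.\<close>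

lemma coercivity_ge_Min_eigenvalue:
  fixes A H :: "complex^'n^'n"
  assumes K: "K = \<real> \<or> K = UNIV" and H: "herm_pos_def UNIV H"
  shows "Min (Re ` eigenvalues (H ** herm_part A)) \<le> coercivity K A H"
  unfolding coercivity_def
proof (rule cINF_greatest[OF nonzero_vecs_nonempty[OF K]])
  fix y :: "complex^'n" assume "y \<in> nonzero_vecs K"
  then have y: "y \<noteq> 0" by (simp add: nonzero_vecs_def)
  note Hi = herm_pos_def_matrix_inv[OF H]
  have cancel: "matrix_inv H ** (H ** herm_part A) = herm_part A"
    by (simp add: matrix_mul_assoc matrix_inv_cancel herm_pos_def_invertible[OF H])
  have "Min (Re ` eigenvalues (H ** herm_part A)) * quad_form (matrix_inv H) y
      \<le> quad_form (herm_part A) y"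
    using rayleigh_ge_Min_eigenvalue[OF Hi, of "H ** herm_part A" y]
    by (simp add: cancel conj_transpose_herm_part)
  also have "\<dots> \<le> \<bar>quad_form A y\<bar>"
    by (simp add: quad_form_def[of "herm_part A"] cinner_herm_part)
  finally show "Min (Re ` eigenvalues (H ** herm_part A)) \<le> \<bar>quad_form A y\<bar> / quad_form (matrix_inv H) y"
    using quad_form_pos[OF Hi y] by (simp add: pos_le_divide_eq)
qed

lemma quad_form_herm_part: "quad_form (herm_part A) x = quad_form A x"
  by (simp add: quad_form_def[of "herm_part A"] cinner_herm_part)

text \<open>Here \<open>v + B v = M\<^sup>-\<^sup>1 A v\<close>.  Its two summands have purely imaginary \<open>M\<close> inner product because
  \<open>N = M B\<close> is skew-Hermitian, so their squared \<open>M\<close>-norms add up.\<close>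

lemma energy_of_preconditioned_operator:
  fixes A :: "complex^'n^'n"
  assumes M: "herm_pos_def UNIV (herm_part A)"
  defines "B \<equiv> matrix_inv (herm_part A) ** skew_part A"
  shows "herm_part A *v (v + B *v v) = A *v v"
    and "quad_form (herm_part A) (v + B *v v)
      \<le> (1 + (spectral_radius B)\<^sup>2) * quad_form (herm_part A) v"
proof -
  note inv = herm_pos_def_invertible[OF M]
  have MB: "herm_part A ** B = skew_part A"
    by (simp add: B_def matrix_mul_assoc matrix_inv_cancel inv)
  have "herm_part A *v (v + B *v v) = (herm_part A + skew_part A) *v v"
    by (simp add: matrix_vector_right_distrib matrix_vector_mul_assoc MB matrix_vector_mult_add_rdistrib)
  then show "herm_part A *v (v + B *v v) = A *v v" by (simp add: herm_part_plus_skew_part)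
  have "cinner (herm_part A *v v) (B *v v) = cinner v (skew_part A *v v)"
    by (simp add: cinner_adjoint conj_transpose_herm_part matrix_vector_mul_assoc MB)
  also have "\<dots> = cnj (cinner (skew_part A *v v) v)" by (rule cinner_commute)
  also have "cinner (skew_part A *v v) v = cinner (A *v v) v - cinner (herm_part A *v v) v"
    by (simp add: cinner_diff_left[symmetric] matrix_vector_mult_diff_rdistrib[symmetric])
      (metis add_diff_cancel_left' herm_part_plus_skew_part)
  finally have cross: "Re (cinner (herm_part A *v v) (B *v v)) = 0"
    by (simp add: cinner_herm_part quad_form_def)
  have "quad_form (herm_part A) (B *v v) \<le> (spectral_radius B)\<^sup>2 * quad_form (herm_part A) v"
    by (rule skew_adjoint_norm_le_spectral_radius[OF M]) (simp add: MB conj_transpose_skew_part)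
  then show "quad_form (herm_part A) (v + B *v v) \<le> (1 + (spectral_radius B)\<^sup>2) * quad_form (herm_part A) v"
    by (simp add: quad_form_add[OF conj_transpose_herm_part] cross algebra_simps)
qed

text \<open>This is the Rayleigh bound for \<open>H M\<close> again, now in the inner product of \<open>M\<close>, where
  \<open>\<langle>M H M u, u\<rangle> = \<langle>H M u, M u\<rangle>\<close>.\<close>

lemma preconditioned_energy_bound:
  fixes A H :: "complex^'n^'n"
  assumes H: "herm_pos_def UNIV H" and M: "herm_pos_def UNIV (herm_part A)"
  shows "quad_form H (herm_part A *v u)
    \<le> Max (Re ` eigenvalues (H ** herm_part A)) * quad_form (herm_part A) u"
proof -
  have herm: "conj_transpose H = H" using H by (simp add: herm_pos_def_UNIV_iff)
  have "quad_form (herm_part A ** (H ** herm_part A)) u = quad_form H (herm_part A *v u)"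
    unfolding quad_form_def
    by (simp add: matrix_vector_mul_assoc[symmetric] cinner_adjoint[of "herm_part A"]
        conj_transpose_herm_part)
  moreover have "conj_transpose (herm_part A ** (H ** herm_part A)) = herm_part A ** (H ** herm_part A)"
    by (simp add: conj_transpose_mult conj_transpose_herm_part herm matrix_mul_assoc)
  ultimately show ?thesis
    using rayleigh_le_Max_eigenvalue[OF M, of "H ** herm_part A" u] by simp
qed

lemma Max_eigenvalue_pos:
  fixes A H :: "complex^'n^'n"
  assumes H: "herm_pos_def UNIV H" and M: "herm_pos_def UNIV (herm_part A)"
  shows "0 < Max (Re ` eigenvalues (H ** herm_part A))"
proof -
  have "0 < quad_form H (herm_part A *v 1)"
    by (intro quad_form_pos[OF H]) (simp add: invertible_mult_vec_eq_0_iff herm_pos_def_invertible[OF M])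
  then have "0 < Max (Re ` eigenvalues (H ** herm_part A)) * quad_form (herm_part A) 1"
    using preconditioned_energy_bound[OF assms] by (rule less_le_trans)
  then show ?thesis
    using quad_form_pos[OF M, of 1] by (simp add: zero_less_mult_iff)
qed

text \<open>With \<open>w = A v = M u\<close> the two energy estimates combine to
  \<open>\<langle>H w, w\<rangle> \<le> \<lambda>\<^sub>m\<^sub>a\<^sub>x \<langle>M u, u\<rangle> \<le> \<lambda>\<^sub>m\<^sub>a\<^sub>x (1 + \<rho>\<^sup>2) \<langle>M v, v\<rangle>\<close>, and \<open>\<langle>M v, v\<rangle> = Re \<langle>A\<^sup>-\<^sup>1 w, w\<rangle>\<close>.\<close>

lemma inverse_coercivity_ge:
  fixes A H :: "complex^'n^'n"
  assumes K: "K = \<real> \<or> K = UNIV" and A: "invertible A"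
    and H: "herm_pos_def UNIV H" and M: "herm_pos_def UNIV (herm_part A)"
  shows "1 / (Max (Re ` eigenvalues (H ** herm_part A))
           * (1 + (spectral_radius (matrix_inv (herm_part A) ** skew_part A))\<^sup>2))
    \<le> inverse_coercivity K A H"
  unfolding inverse_coercivity_def
proof (rule cINF_greatest[OF nonzero_vecs_nonempty[OF K]])
  fix w :: "complex^'n" assume "w \<in> nonzero_vecs K"
  then have w: "w \<noteq> 0" by (simp add: nonzero_vecs_def)
  define \<Lambda> where "\<Lambda> = Max (Re ` eigenvalues (H ** herm_part A))"
  define B where "B = matrix_inv (herm_part A) ** skew_part A"
  define \<sigma> where "\<sigma> = 1 + (spectral_radius B)\<^sup>2"
  have \<Lambda>: "\<Lambda> > 0" unfolding \<Lambda>_def by (rule Max_eigenvalue_pos[OF H M])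
  have \<sigma>: "\<sigma> > 0" unfolding \<sigma>_def by (simp add: add_pos_nonneg)
  define v where "v = matrix_inv A *v w"
  have Av: "A *v v = w" by (simp add: v_def matrix_inv_mult_vec A)
  have "quad_form H w = quad_form H (herm_part A *v (v + B *v v))"
    unfolding B_def energy_of_preconditioned_operator(1)[OF M] Av ..
  also have "\<dots> \<le> \<Lambda> * quad_form (herm_part A) (v + B *v v)"
    unfolding \<Lambda>_def by (rule preconditioned_energy_bound[OF H M])
  also have "\<dots> \<le> \<Lambda> * (\<sigma> * quad_form (herm_part A) v)"
    unfolding \<sigma>_def B_def
    by (intro mult_left_mono energy_of_preconditioned_operator(2)[OF M] less_imp_le \<Lambda>)
  also have "quad_form (herm_part A) v = quad_form (matrix_inv A) w"
    using quad_form_matrix_inv[OF A, of v] by (simp add: Av quad_form_herm_part)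
  also have "\<Lambda> * (\<sigma> * quad_form (matrix_inv A) w) \<le> \<Lambda> * (\<sigma> * \<bar>quad_form (matrix_inv A) w\<bar>)"
    using \<Lambda> \<sigma> by (intro mult_left_mono) auto
  finally have "1 / (\<Lambda> * \<sigma>) \<le> \<bar>quad_form (matrix_inv A) w\<bar> / quad_form H w"
    using \<Lambda> \<sigma> quad_form_pos[OF H w] by (simp add: field_simps)
  then show "1 / (Max (Re ` eigenvalues (H ** herm_part A))
           * (1 + (spectral_radius (matrix_inv (herm_part A) ** skew_part A))\<^sup>2))
    \<le> \<bar>quad_form (matrix_inv A) w\<bar> / quad_form H w"
    by (simp add: \<Lambda>_def \<sigma>_def B_def)
qed

lemma gmres_bound2_le_bound3:
  fixes A H :: "complex^'n^'n"
  assumes K: "K = \<real> \<or> K = UNIV" and mats: "A \<in> mats K" "H \<in> mats K"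
    and A: "invertible A" and H: "herm_pos_def UNIV H" and M: "herm_pos_def UNIV (herm_part A)"
  shows "gmres_bound2 K A H i \<le> gmres_bound3 A H i"
proof -
  let ?E = "Re ` eigenvalues (H ** herm_part A)"
  let ?\<sigma> = "1 + (spectral_radius (matrix_inv (herm_part A) ** skew_part A))\<^sup>2"
  have "?\<sigma> > 0" by (simp add: add_pos_nonneg)
  then have "1 / (Max ?E * ?\<sigma>) * Min ?E \<le> 1 / (Max ?E * ?\<sigma>) * coercivity K A H"
    using Max_eigenvalue_pos[OF H M] by (intro mult_left_mono coercivity_ge_Min_eigenvalue[OF K H]) simp
  also have "\<dots> \<le> inverse_coercivity K A H * coercivity K A H"
    unfolding coercivity_def
    by (intro mult_right_mono inverse_coercivity_ge[OF K A H M]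
        INF_abs_form_bounds(2)[OF herm_pos_def_matrix_inv[OF H] nonzero_vecs_nonempty[OF K]])
  finally have "(1 / cond_number (H ** herm_part A)) / ?\<sigma> \<le> inverse_coercivity K A H * coercivity K A H"
    by (simp add: cond_number_def)
  moreover have "inverse_coercivity K A H * coercivity K A H \<le> 1"
    using coercivity_product_le_INF_quotient[OF K mats A H]
      INF_quotient_bounds(2)[OF H nonzero_vecs_nonempty[OF K], of "A ** H"] by linarith
  ultimately show ?thesis
    unfolding gmres_bound2_alt gmres_bound3_def by (intro half_power_mono) auto
qed

theorem theorem1:
  fixes K :: "complex set"
    and A H W :: "complex^'n^'n"
    and b x0 :: "complex^'n"
    and x r :: "nat \<Rightarrow> complex^'n"
  assumes K: "K = \<real> \<or> K = UNIV"
    and mats: "A \<in> mats K" "H \<in> mats K" "W \<in> mats K"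
    and nonsingular: "invertible A" "invertible H"
    and W: "herm_pos_def K W"
    and vecs: "b \<in> vecs K" "x0 \<in> vecs K"
    and r0: "b - A *v x0 \<noteq> 0"
    and iterates: "\<And>i. wp_gmres_iterate K A H W b x0 i (x i)"
    and residuals: "\<And>i. r i = b - A *v x i"
  shows "\<forall>i.
      wnorm W (r i) / wnorm W (b - A *v x0) \<le> gmres_bound1 K A H W i \<and>
      (H = W \<longrightarrow>
        gmres_bound1 K A H W i \<le> gmres_bound2 K A H i \<and>
        wnorm W (r i) / wnorm W (b - A *v x0) \<le> gmres_bound2 K A H i) \<and>
      (H = W \<and> pos_def K A \<longrightarrow>
        gmres_bound2 K A H i \<le> gmres_bound3 A H i \<and>
        wnorm W (r i) / wnorm W (b - A *v x0) \<le> gmres_bound3 A H i)"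

proof
  fix i
  have Wc: "herm_pos_def UNIV W"
    by (rule herm_pos_def_complexify[OF K mats(3) W])
  have "0 < (wnorm W (b - A *v x0))\<^sup>2"
    using quad_form_pos[OF Wc r0] by (simp add: wnorm_power2[OF Wc])
  then have "0 < wnorm W (b - A *v x0)"
    using wnorm_nonneg[OF Wc, of "b - A *v x0"] by (simp add: less_le)
  then have 1: "wnorm W (r i) / wnorm W (b - A *v x0) \<le> gmres_bound1 K A H W i"
    using wp_gmres_residual_le_bound1[OF K mats nonsingular Wc vecs iterates, of i]
    by (simp add: residuals pos_divide_le_eq)
  have 2: "gmres_bound1 K A H W i \<le> gmres_bound2 K A H i" if "H = W"
    using gmres_bound1_le_bound2[OF K mats(1,2) nonsingular(1)] Wc that by simp
  have 3: "gmres_bound2 K A H i \<le> gmres_bound3 A H i" if "H = W" "pos_def K A"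
  proof -
    have "herm_pos_def UNIV (herm_part A)"
      using herm_pos_def_complexify[OF K herm_part_mats[OF K mats(1)]] that(2)
      by (simp add: pos_def_def)
    then show ?thesis
      using gmres_bound2_le_bound3[OF K mats(1,2) nonsingular(1)] Wc that(1) by simp
  qed
  show "wnorm W (r i) / wnorm W (b - A *v x0) \<le> gmres_bound1 K A H W i \<and>
      (H = W \<longrightarrow>
        gmres_bound1 K A H W i \<le> gmres_bound2 K A H i \<and>
        wnorm W (r i) / wnorm W (b - A *v x0) \<le> gmres_bound2 K A H i) \<and>
      (H = W \<and> pos_def K A \<longrightarrow>
        gmres_bound2 K A H i \<le> gmres_bound3 A H i \<and>
        wnorm W (r i) / wnorm W (b - A *v x0) \<le> gmres_bound3 A H i)"
    using 1 2 3 by (meson order_trans)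
qed

end
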